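(* Let $m,n>0$ and $c_1,c_2,c_3\in\mathbb{R}$ with $mc_1-mn-n^2\neq0$ and $nc_1+mn+m^2\neq0$. Let $\gamma:\mathbb{R}\to\mathrm{Sol}^3_{m,n}$, $\gamma(s)=(x(s),y(s),t(s))$, be the integral curve $$x(s)=a_1e^{(mc_1-mn-n^2)s}-\frac{c_2}{mc_1-mn-n^2},\quad y(s)=a_2e^{-(nc_1+mn+m^2)s}-\frac{c_3}{nc_1+mn+m^2},\quad t(s)=c_1s+t_0$$ ($a_1,a_2,t_0\in\mathbb{R}$) of the Ricci soliton vector field $\xi=\left[(mc_1-mn-n^2)x+c_2\right]\partial_x-\left[(nc_1+mn+m^2)y+c_3\right]\partial_y+c_1\partial_t$. Then $\gamma$ is a geodesic of $(\mathrm{Sol}^3_{m,n},g)$, where $g=e^{-2mt}dx^2+e^{2nt}dy^2+dt^2$, if and only if $$\begin{cases}a_1\left(m^2c_1^2-m^2n^2-2mn^3-n^4\right)=0,\\[1mm] a_2\left(n^2c_1^2-m^2n^2-2m^3n-m^4\right)=0,\\[1mm] m\,a_1^2\left(mc_1-mn-n^2\right)^2e^{-2n^2s-2mt_0}=n\,a_2^2\left(nc_1+mn+m^2\right)^2e^{-2m^2s+2nt_0}\quad\text{for all } s\in\mathbb{R}.\end{cases}$$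
   Context: For real $m,n>0$, $\mathrm{Sol}^3_{m,n}$ is the semidirect product $\mathbb{R}^2\rtimes_U\mathbb{R}$ with $U(t)=\mathrm{diag}(e^{mt},e^{-nt})$; its underlying manifold is $\mathbb{R}^3$ with global coordinates $(x,y,t)$. It carries the left-invariant Riemannian metric $g=e^{-2mt}dx^2+e^{2nt}dy^2+dt^2$. A curve $\gamma$ is a geodesic if the covariant derivative of $\gamma'$ along $\gamma$ (Levi-Civita connection of $g$) vanishes. The vector fields $\xi$ in the claim are the vector fields satisfying the Ricci soliton equation $\operatorname{Ric}+\frac12\mathcal{L}_\xi g=\lambda g$ for some constant $\lambda$. *)

theory Defs
  imports "HOL-Analysis.Analysis"
begin

section \<open>Riemannian geometry in global coordinates\<close>

text \<open>
  All manifolds here carry one global chart, so a manifold is \<open>real ^ 'n\<close>, every tangent space is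
  identified with \<open>real ^ 'n\<close> through the coordinate frame, a vector field is a function
  \<open>X :: real ^ 'n \<Rightarrow> real ^ 'n\<close> and a metric maps a point \<open>p\<close> to the bilinear form \<open>g p\<close>. The
  coordinate fields are the constant functions \<open>\<lambda>_. axis i 1\<close>.
\<close>

type_synonym 'n field = "real ^ 'n \<Rightarrow> real ^ 'n"
type_synonym 'n metric_field = "real ^ 'n \<Rightarrow> real ^ 'n \<Rightarrow> real ^ 'n \<Rightarrow> real"
type_synonym 'n connection_form = "real ^ 'n \<Rightarrow> real ^ 'n \<Rightarrow> real ^ 'n \<Rightarrow> real ^ 'n"

definition riemannian_metric :: "('n::finite) metric_field \<Rightarrow> bool" where
  "riemannian_metric g \<longleftrightarrow>
     (\<forall>p. bilinear (g p)) \<and>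
     (\<forall>p u v. g p u v = g p v u) \<and>
     (\<forall>p u. u \<noteq> 0 \<longrightarrow> g p u u > 0) \<and>
     (\<forall>p u v. (\<lambda>q. g q u v) differentiable (at p))"

definition lie_bracket :: "('n::finite) field \<Rightarrow> 'n field \<Rightarrow> 'n field" where
  "lie_bracket X Y p =
     frechet_derivative Y (at p) (X p) - frechet_derivative X (at p) (Y p)"

text \<open>
  A connection is \<open>\<nabla>\<^sub>X Y = D\<^sub>X Y + \<Gamma>(X, Y)\<close>, with \<open>D\<close> the flat derivative of the chart and
  \<open>\<Gamma> p\<close> bilinear. The coordinates of \<open>\<Gamma> p (axis i 1) (axis j 1)\<close> are the Christoffel symbols.
\<close>

definition nabla :: "('n::finite) connection_form \<Rightarrow> 'n field \<Rightarrow> 'n field \<Rightarrow> 'n field" where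
  "nabla \<Gamma> X Y p = frechet_derivative Y (at p) (X p) + \<Gamma> p (X p) (Y p)"

text \<open>
  Torsion-freeness and compatibility with \<open>g\<close> are tensorial, hence imposed on constant fields
  only; see \<open>levi_civita_torsion_free\<close> and \<open>levi_civita_compatible\<close> for arbitrary fields.
\<close>

definition is_levi_civita :: "('n::finite) metric_field \<Rightarrow> 'n connection_form \<Rightarrow> bool" where
  "is_levi_civita g \<Gamma> \<longleftrightarrow>
     (\<forall>p. bilinear (\<Gamma> p)) \<and>
     (\<forall>p u v. \<Gamma> p u v = \<Gamma> p v u) \<and>
     (\<forall>p u v w. frechet_derivative (\<lambda>q. g q v w) (at p) u = g p (\<Gamma> p u v) w + g p v (\<Gamma> p u w))"

definition levi_civita :: "('n::finite) metric_field \<Rightarrow> 'n connection_form" where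
  "levi_civita g = (THE \<Gamma>. is_levi_civita g \<Gamma>)"

definition covariant_derivative_along ::
  "('n::finite) metric_field \<Rightarrow> (real \<Rightarrow> real ^ 'n) \<Rightarrow> (real \<Rightarrow> real ^ 'n) \<Rightarrow> real \<Rightarrow> real ^ 'n" where
  "covariant_derivative_along g \<gamma> V s =
     vector_derivative V (at s) + levi_civita g (\<gamma> s) (vector_derivative \<gamma> (at s)) (V s)"

definition geodesic :: "('n::finite) metric_field \<Rightarrow> (real \<Rightarrow> real ^ 'n) \<Rightarrow> bool" where
  "geodesic g \<gamma> \<longleftrightarrow>
     (\<forall>s. \<gamma> differentiable (at s)) \<and>
     (\<forall>s. (\<lambda>r. vector_derivative \<gamma> (at r)) differentiable (at s)) \<and>
     (\<forall>s. covariant_derivative_along g \<gamma> (\<lambda>r. vector_derivative \<gamma> (at r)) s = 0)"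

definition integral_curve :: "('n::finite) field \<Rightarrow> (real \<Rightarrow> real ^ 'n) \<Rightarrow> bool" where
  "integral_curve \<xi> \<gamma> \<longleftrightarrow> (\<forall>s. (\<gamma> has_vector_derivative \<xi> (\<gamma> s)) (at s))"

definition curvature ::
  "('n::finite) metric_field \<Rightarrow> 'n field \<Rightarrow> 'n field \<Rightarrow> 'n field \<Rightarrow> 'n field" where
  "curvature g X Y Z p =
     nabla (levi_civita g) X (nabla (levi_civita g) Y Z) p
     - nabla (levi_civita g) Y (nabla (levi_civita g) X Z) p
     - nabla (levi_civita g) (lie_bracket X Y) Z p"

text \<open>
  \<open>Ric(u, v)\<close> is the trace of \<open>w \<mapsto> R(w, u) v\<close>. Tangent vectors are extended to constant fields,
  here and in \<open>lie_derivative\<close>; the values are independent of the extension.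
\<close>

definition ricci :: "('n::finite) metric_field \<Rightarrow> 'n metric_field" where
  "ricci g p u v = (\<Sum>i\<in>UNIV. curvature g (\<lambda>_. axis i 1) (\<lambda>_. u) (\<lambda>_. v) p $ i)"

definition lie_derivative :: "('n::finite) field \<Rightarrow> 'n metric_field \<Rightarrow> 'n metric_field" where
  "lie_derivative \<xi> g p u v =
     frechet_derivative (\<lambda>q. g q u v) (at p) (\<xi> p)
     - g p (lie_bracket \<xi> (\<lambda>_. u) p) v - g p u (lie_bracket \<xi> (\<lambda>_. v) p)"

definition ricci_soliton :: "('n::finite) metric_field \<Rightarrow> 'n field \<Rightarrow> bool" where
  "ricci_soliton g \<xi> \<longleftrightarrow>
     (\<forall>p. \<xi> differentiable (at p)) \<and>
     (\<exists>lam::real. \<forall>p u v. ricci g p u v + 1/2 * lie_derivative \<xi> g p u v = lam * g p u v)"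


section \<open>The Levi-Civita connection\<close>

lemma riemannian_metric_nondegenerate:
  assumes "riemannian_metric g" and "\<And>w. g p z w = g p z' w"
  shows "z = z'"
proof (rule ccontr)
  assume "z \<noteq> z'"
  then have "g p (z - z') (z - z') > 0"
    using assms(1) by (auto simp: riemannian_metric_def)
  moreover have "g p (z - z') (z - z') = 0"
    using assms(2)[of "z - z'"] bilinear_lsub[of "g p" z z' "z - z'"] assms(1)
    by (simp add: riemannian_metric_def)
  ultimately show False by simp
qed

lemma koszul:
  assumes "riemannian_metric g" and "is_levi_civita g \<Gamma>"
  shows "g p (\<Gamma> p u v) w =
     (frechet_derivative (\<lambda>q. g q v w) (at p) u + frechet_derivative (\<lambda>q. g q u w) (at p) v
      - frechet_derivative (\<lambda>q. g q u v) (at p) w) / 2"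
proof -
  have sg: "g p a b = g p b a" for a b
    using assms(1) by (simp add: riemannian_metric_def)
  have sG: "\<Gamma> p a b = \<Gamma> p b a" for a b
    using assms(2) by (simp add: is_levi_civita_def)
  have c: "frechet_derivative (\<lambda>q. g q b d) (at p) a = g p (\<Gamma> p a b) d + g p b (\<Gamma> p a d)" for a b d
    using assms(2) by (simp add: is_levi_civita_def)
  show ?thesis
    unfolding c using sg sG[of v u] sG[of w u] sG[of w v] by simp
qed

lemma is_levi_civita_unique:
  assumes "riemannian_metric g" "is_levi_civita g \<Gamma>" "is_levi_civita g \<Gamma>'"
  shows "\<Gamma> = \<Gamma>'"
proof (intro ext)
  fix p u v
  show "\<Gamma> p u v = \<Gamma>' p u v"
    by (rule riemannian_metric_nondegenerate[OF assms(1), of p])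
       (simp add: koszul[OF assms(1,2)] koszul[OF assms(1,3)])
qed

lemma levi_civita_eqI:
  assumes "riemannian_metric g" and "is_levi_civita g \<Gamma>"
  shows "levi_civita g = \<Gamma>"
  unfolding levi_civita_def
  using assms is_levi_civita_unique by blast

lemma riemannian_metric_represents:
  fixes g :: "('n::finite) metric_field"
  assumes "riemannian_metric g" and "linear (\<phi> :: real ^ 'n \<Rightarrow> real)"
  shows "\<exists>z. \<forall>w. g p z w = \<phi> w"
proof -
  have bil: "bilinear (g p)"
    using assms(1) by (simp add: riemannian_metric_def)
  define T :: "real ^ 'n \<Rightarrow> real ^ 'n" where "T z = (\<chi> i. g p z (axis i 1))" for z
  have expand: "f w = (\<Sum>i\<in>UNIV. w $ i * f (axis i 1))" if "linear f" for f :: "real ^ 'n \<Rightarrow> real" and w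
  proof -
    have "f w = f (\<Sum>i\<in>UNIV. w $ i *\<^sub>R axis i 1)"
      using basis_expansion[of w] by (simp add: scalar_mult_eq_scaleR)
    also have "\<dots> = (\<Sum>i\<in>UNIV. w $ i * f (axis i 1))"
      using that by (simp add: linear_sum linear_cmul)
    finally show ?thesis .
  qed
  have lin: "linear (g p z)" for z
    using bil by (simp add: bilinear_def)
  have "linear T"
    by (rule linearI) (simp_all add: T_def vec_eq_iff bilinear_ladd[OF bil] bilinear_lmul[OF bil])
  moreover have "inj T"
  proof (rule injI)
    fix z z' assume "T z = T z'"
    then have "g p z (axis i 1) = g p z' (axis i 1)" for i
      by (simp add: T_def vec_eq_iff)
    then have "g p z w = g p z' w" for w
      using expand[OF lin, of z w] expand[OF lin, of z' w] by simp
    then show "z = z'"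
      by (rule riemannian_metric_nondegenerate[OF assms(1)])
  qed
  ultimately have "surj T"
    by (rule linear_injective_imp_surjective) simp
  then obtain z where "T z = (\<chi> i. \<phi> (axis i 1))"
    by (metis surjD)
  then have "g p z (axis i 1) = \<phi> (axis i 1)" for i
    by (simp add: T_def vec_eq_iff)
  then have "g p z w = \<phi> w" for w
    using expand[OF lin, of z w] expand[OF assms(2), of w] by simp
  then show ?thesis by blast
qed

lemma levi_civita_exists:
  assumes g: "riemannian_metric g"
  shows "is_levi_civita g (levi_civita g)"
proof -
  have bil: "bilinear (g p)" for p
    using g by (simp add: riemannian_metric_def)
  have sg: "g p a b = g p b a" for p a b
    using g by (simp add: riemannian_metric_def)
  have df: "(\<lambda>q. g q a b) differentiable (at p)" for p a b
    using g by (simp add: riemannian_metric_def)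
  let ?d = "\<lambda>p u v w. frechet_derivative (\<lambda>q. g q v w) (at p) u"
  define K where "K p u v w = (?d p u v w + ?d p v u w - ?d p w u v) / 2" for p u v w
  have d1: "linear (\<lambda>u. ?d p u v w)" for p v w
    using linear_frechet_derivative[OF df] .
  have hd: "((\<lambda>q. g q v w) has_derivative (\<lambda>u. ?d p u v w)) (at p)" for p v w
    using df frechet_derivative_works by blast
  have d3: "linear (?d p u v)" for p u v
  proof (rule linearI)
    fix a b :: "real ^ 'a" and c :: real
    have "((\<lambda>q. g q v (a + b)) has_derivative (\<lambda>u. ?d p u v a + ?d p u v b)) (at p)"
      using has_derivative_add[OF hd hd] by (simp add: bilinear_radd[OF bil])
    then show "?d p u v (a + b) = ?d p u v a + ?d p u v b"
      by (rule fun_cong[OF frechet_derivative_at[symmetric]])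
    have "((\<lambda>q. g q v (c *\<^sub>R a)) has_derivative (\<lambda>u. c * ?d p u v a)) (at p)"
      using has_derivative_mult_right[OF hd] by (simp add: bilinear_rmul[OF bil])
    then have "?d p u v (c *\<^sub>R a) = c * ?d p u v a"
      by (rule fun_cong[OF frechet_derivative_at[symmetric]])
    then show "?d p u v (c *\<^sub>R a) = c *\<^sub>R ?d p u v a"
      by simp
  qed
  have ds: "?d p u v w = ?d p u w v" for p u v w
    using sg by simp
  have "linear (K p u v)" for p u v
    by (rule linearI)
       (simp_all add: K_def linear_add[OF d3] linear_cmul[OF d3] linear_add[OF d1]
         linear_cmul[OF d1] algebra_simps add_divide_distrib diff_divide_distrib)
  then have "\<exists>z. \<forall>w. g p z w = K p u v w" for p u v
    by (rule riemannian_metric_represents[OF g])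
  then obtain \<Gamma> where G: "g p (\<Gamma> p u v) w = K p u v w" for p u v w
    by metis
  have sG: "\<Gamma> p u v = \<Gamma> p v u" for p u v
    by (rule riemannian_metric_nondegenerate[OF g, of p]) (use ds in \<open>simp add: G K_def\<close>)
  have lG: "linear (\<Gamma> p u)" for p u
  proof (rule linearI)
    fix a b :: "real ^ 'a" and c :: real
    have L: "?d p x (a + b) w = ?d p x a w + ?d p x b w" "?d p x (c *\<^sub>R a) w = c * ?d p x a w" for x w
      unfolding ds[where v = "_ + _" and w = w] ds[where v = "_ *\<^sub>R _" and w = w]
        ds[where v = a and w = w] ds[where v = b and w = w]
      by (simp_all add: linear_add[OF d3] linear_cmul[OF d3])
    have KL: "K p u (a + b) w = K p u a w + K p u b w" "K p u (c *\<^sub>R a) w = c * K p u a w" for w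
      unfolding K_def L linear_add[OF d1] linear_cmul[OF d1] linear_add[OF d3] linear_cmul[OF d3]
      by (simp_all add: field_simps)
    show "\<Gamma> p u (a + b) = \<Gamma> p u a + \<Gamma> p u b"
      by (rule riemannian_metric_nondegenerate[OF g, of p]) (simp add: G bilinear_ladd[OF bil] KL)
    show "\<Gamma> p u (c *\<^sub>R a) = c *\<^sub>R \<Gamma> p u a"
      by (rule riemannian_metric_nondegenerate[OF g, of p]) (simp add: G bilinear_lmul[OF bil] KL)
  qed
  have "is_levi_civita g \<Gamma>"
    unfolding is_levi_civita_def
  proof (intro conjI allI)
    fix p u v w
    show "bilinear (\<Gamma> p)"
      unfolding bilinear_def using lG sG by (metis (no_types, lifting) ext)
    show "\<Gamma> p u v = \<Gamma> p v u"
      by (rule sG)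
    show "?d p u v w = g p (\<Gamma> p u v) w + g p v (\<Gamma> p u w)"
      unfolding sg[of p v "\<Gamma> p u w"] G K_def
      using ds[where p = p and u = u and v = v and w = w] ds[where p = p and u = v and v = u and w = w]
        ds[where p = p and u = w and v = u and w = v]
      by (simp add: field_simps)
  qed
  then show ?thesis
    using levi_civita_eqI[OF g] by simp
qed

lemma levi_civita_torsion_free:
  assumes "riemannian_metric g"
  shows "nabla (levi_civita g) X Y p - nabla (levi_civita g) Y X p = lie_bracket X Y p"
  using levi_civita_exists[OF assms]
  by (simp add: nabla_def lie_bracket_def is_levi_civita_def)

lemma levi_civita_compatible:
  assumes g: "riemannian_metric g" and "Y differentiable (at p)" and "Z differentiable (at p)"
  shows "frechet_derivative (\<lambda>q. g q (Y q) (Z q)) (at p) (X p) =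
     g p (nabla (levi_civita g) X Y p) (Z p) + g p (Y p) (nabla (levi_civita g) X Z p)"
proof -
  have bil: "bilinear (g q)" for q
    using g by (simp add: riemannian_metric_def)
  have df: "(\<lambda>q. g q a b) differentiable (at p)" for a b
    using g by (simp add: riemannian_metric_def)
  let ?e = "\<lambda>i. axis i (1::real) :: real ^ 'a"
  let ?DY = "frechet_derivative Y (at p)" and ?DZ = "frechet_derivative Z (at p)"
  have E: "g q v w = (\<Sum>i\<in>UNIV. \<Sum>j\<in>UNIV. v $ i * w $ j * g q (?e i) (?e j))" for q v w
  proof -
    have "g q v w = g q (\<Sum>i\<in>UNIV. v $ i *\<^sub>R ?e i) (\<Sum>j\<in>UNIV. w $ j *\<^sub>R ?e j)"
      using basis_expansion[of v] basis_expansion[of w] by (simp add: scalar_mult_eq_scaleR)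
    also have "\<dots> = (\<Sum>(i, j)\<in>UNIV \<times> UNIV. g q (v $ i *\<^sub>R ?e i) (w $ j *\<^sub>R ?e j))"
      by (rule bilinear_sum[OF bil])
    also have "\<dots> = (\<Sum>i\<in>UNIV. \<Sum>j\<in>UNIV. v $ i * w $ j * g q (?e i) (?e j))"
      by (simp add: sum.cartesian_product bilinear_lmul[OF bil] bilinear_rmul[OF bil] mult_ac)
    finally show ?thesis .
  qed
  let ?dg = "\<lambda>a b. frechet_derivative (\<lambda>q. g q a b) (at p)"
  have hg: "((\<lambda>q. g q a b) has_derivative ?dg a b) (at p)" for a b
    using df frechet_derivative_works by blast
  have hY: "((\<lambda>q. Y q $ i) has_derivative (\<lambda>h. ?DY h $ i)) (at p)" for i
    using assms(2) frechet_derivative_works bounded_linear.has_derivative[OF bounded_linear_vec_nth]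
    by blast
  have hZ: "((\<lambda>q. Z q $ i) has_derivative (\<lambda>h. ?DZ h $ i)) (at p)" for i
    using assms(3) frechet_derivative_works bounded_linear.has_derivative[OF bounded_linear_vec_nth]
    by blast
  have Edg: "?dg v w = (\<lambda>h. \<Sum>i\<in>UNIV. \<Sum>j\<in>UNIV. v $ i * w $ j * ?dg (?e i) (?e j) h)" for v w
  proof (rule frechet_derivative_at[symmetric])
    show "((\<lambda>q. g q v w) has_derivative
        (\<lambda>h. \<Sum>i\<in>UNIV. \<Sum>j\<in>UNIV. v $ i * w $ j * ?dg (?e i) (?e j) h)) (at p)"
      by (subst E) (intro has_derivative_sum has_derivative_mult_right hg)
  qed
  have "((\<lambda>q. g q (Y q) (Z q)) has_derivative (\<lambda>h. \<Sum>i\<in>UNIV. \<Sum>j\<in>UNIV.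
      (Y p $ i * Z p $ j) * ?dg (?e i) (?e j) h
      + (Y p $ i * ?DZ h $ j + ?DY h $ i * Z p $ j) * g p (?e i) (?e j))) (at p)"
    by (subst E) (intro has_derivative_sum has_derivative_mult hg hY hZ)
  then have "frechet_derivative (\<lambda>q. g q (Y q) (Z q)) (at p) = (\<lambda>h. \<Sum>i\<in>UNIV. \<Sum>j\<in>UNIV.
      (Y p $ i * Z p $ j) * ?dg (?e i) (?e j) h
      + (Y p $ i * ?DZ h $ j + ?DY h $ i * Z p $ j) * g p (?e i) (?e j))"
    by (rule frechet_derivative_at[symmetric])
  also have "\<dots> = (\<lambda>h. ?dg (Y p) (Z p) h + (g p (Y p) (?DZ h) + g p (?DY h) (Z p)))"
    unfolding Edg[of "Y p" "Z p"] E[of p "Y p"] E[of p _ "Z p"]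
    by (simp add: sum.distrib distrib_right)
  finally have "frechet_derivative (\<lambda>q. g q (Y q) (Z q)) (at p) (X p) =
      ?dg (Y p) (Z p) (X p) + (g p (Y p) (?DZ (X p)) + g p (?DY (X p)) (Z p))"
    by simp
  moreover have "?dg (Y p) (Z p) (X p) =
      g p (levi_civita g p (X p) (Y p)) (Z p) + g p (Y p) (levi_civita g p (X p) (Z p))"
    using levi_civita_exists[OF g] by (simp add: is_levi_civita_def)
  ultimately show ?thesis
    by (simp add: nabla_def bilinear_ladd[OF bil] bilinear_radd[OF bil])
qed


section \<open>The groups \<open>Sol\<^sup>3\<close>\<close>

definition sol_mult :: "real \<Rightarrow> real \<Rightarrow> real ^ 3 \<Rightarrow> real ^ 3 \<Rightarrow> real ^ 3" where
  "sol_mult m n p q =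
     vector [p $ 1 + exp (m * p $ 3) * q $ 1, p $ 2 + exp (- n * p $ 3) * q $ 2, p $ 3 + q $ 3]"

definition sol_metric :: "real \<Rightarrow> real \<Rightarrow> 3 metric_field" where
  "sol_metric m n p u v =
     exp (- 2 * m * p $ 3) * u $ 1 * v $ 1 + exp (2 * n * p $ 3) * u $ 2 * v $ 2 + u $ 3 * v $ 3"

lemma vec3_eq_iff: "(p :: 'a ^ 3) = q \<longleftrightarrow> p $ 1 = q $ 1 \<and> p $ 2 = q $ 2 \<and> p $ 3 = q $ 3"
  by (simp add: vec_eq_iff forall_3)

lemma riemannian_metric_sol_metric: "riemannian_metric (sol_metric m n)"
  unfolding riemannian_metric_def
proof (intro conjI allI impI)
  fix p u v :: "real ^ 3"
  show "bilinear (sol_metric m n p)"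
    by (auto simp: bilinear_def sol_metric_def algebra_simps intro!: linearI)
  show "sol_metric m n p u v = sol_metric m n p v u"
    by (simp add: sol_metric_def)
  show "sol_metric m n p u u > 0" if "u \<noteq> 0"
  proof -
    have a: "exp (- 2 * m * p $ 3) * u $ 1 * u $ 1 \<ge> 0" "exp (2 * n * p $ 3) * u $ 2 * u $ 2 \<ge> 0"
      "u $ 3 * u $ 3 \<ge> 0"
      by (simp_all add: mult.assoc)
    have "u $ 1 \<noteq> 0 \<or> u $ 2 \<noteq> 0 \<or> u $ 3 \<noteq> 0"
      using that by (simp add: vec3_eq_iff)
    then have "exp (- 2 * m * p $ 3) * u $ 1 * u $ 1 \<noteq> 0 \<or> exp (2 * n * p $ 3) * u $ 2 * u $ 2 \<noteq> 0
      \<or> u $ 3 * u $ 3 \<noteq> 0"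
      by simp
    with a show ?thesis
      unfolding sol_metric_def by linarith
  qed
  show "(\<lambda>q. sol_metric m n q u v) differentiable (at p)"
    unfolding sol_metric_def differentiable_def
    by (rule exI) (rule derivative_eq_intros refl bounded_linear_imp_has_derivative
      bounded_linear_vec_nth)+
qed

lemma sol_metric_left_invariant:
  "sol_metric m n (sol_mult m n a p)
     (frechet_derivative (sol_mult m n a) (at p) u) (frechet_derivative (sol_mult m n a) (at p) v) =
   sol_metric m n p u v"
proof -
  have "(sol_mult m n a has_derivative
      (\<lambda>h. vector [exp (m * a $ 3) * h $ 1, exp (- n * a $ 3) * h $ 2, h $ 3])) (at p)"
  proof (subst has_derivative_componentwise_within, rule ballI)
    fix b :: "real ^ 3" assume "b \<in> Basis"
    then obtain i where "b = axis i 1"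
      by (auto simp: Basis_vec_def)
    then have i: "b = axis 1 1 \<or> b = axis 2 1 \<or> b = axis 3 1"
      using exhaust_3[of i] by blast
    have "((\<lambda>x. x $ k) has_derivative (\<lambda>h. h $ k)) (at p)" for k :: 3
      by (rule bounded_linear_imp_has_derivative[OF bounded_linear_vec_nth])
    then have "((\<lambda>x. c + d * x $ k) has_derivative (\<lambda>h. d * h $ k)) (at p)" for c d and k :: 3
      using has_derivative_add[OF has_derivative_const has_derivative_mult_right] by fastforce
    from this[of _ 1] this show "((\<lambda>x. sol_mult m n a x \<bullet> b) has_derivative
        (\<lambda>h. vector [exp (m * a $ 3) * h $ 1, exp (- n * a $ 3) * h $ 2, h $ 3] \<bullet> b)) (at p)"
      using i by (auto simp: sol_mult_def inner_axis)
  qed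
  then have "frechet_derivative (sol_mult m n a) (at p) =
      (\<lambda>h. vector [exp (m * a $ 3) * h $ 1, exp (- n * a $ 3) * h $ 2, h $ 3])"
    by (rule frechet_derivative_at[symmetric])
  moreover have
    "exp (- 2 * m * p $ 3) = exp (- 2 * m * (a $ 3 + p $ 3)) * (exp (m * a $ 3) * exp (m * a $ 3))"
    "exp (2 * n * p $ 3) = exp (2 * n * (a $ 3 + p $ 3)) * (exp (- n * a $ 3) * exp (- n * a $ 3))"
    unfolding exp_add[symmetric] by (simp_all add: algebra_simps)
  ultimately show ?thesis
    unfolding sol_metric_def sol_mult_def by (simp only: vector_3 mult_ac)
qed

end

theory Submission
  imports Defs
begin

text \<open>
  The Christoffel symbols of \<open>g\<close> have a closed form. They give
  \<open>Ric = (m n - m\<^sup>2) e\<^sup>-\<^sup>2\<^sup>m\<^sup>t dx\<^sup>2 + (m n - n\<^sup>2) e\<^sup>2\<^sup>n\<^sup>t dy\<^sup>2 - (m\<^sup>2 + n\<^sup>2) dt\<^sup>2\<close>, so \<open>\<xi>\<close> is a soliton with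
  \<open>\<lambda> = - (m\<^sup>2 + n\<^sup>2)\<close>, and the geodesic equations
  \<open>x'' = 2 m x' t'\<close>, \<open>y'' = - 2 n y' t'\<close>, \<open>t'' + m e\<^sup>-\<^sup>2\<^sup>m\<^sup>t x'\<^sup>2 = n e\<^sup>2\<^sup>n\<^sup>t y'\<^sup>2\<close>. With
  \<open>A = m c\<^sub>1 - m n - n\<^sup>2\<close> and \<open>B = n c\<^sub>1 + m n + m\<^sup>2\<close>, the first two become
  \<open>a\<^sub>1 A (A - 2 m c\<^sub>1) = 0\<close> and \<open>a\<^sub>2 B (B - 2 n c\<^sub>1) = 0\<close> along \<open>\<gamma>\<close>.
\<close>

text \<open>Turns a coordinate triple into a sum of scaled constants, so that the derivative rules
  for sums and scalings apply.\<close>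

lemma vector_3_eq_axis:
  "(vector [a, b, c] :: real ^ 3) = a *\<^sub>R axis 1 1 + b *\<^sub>R axis 2 1 + c *\<^sub>R axis 3 1"
  by (simp add: vec3_eq_iff axis_def)

lemma has_derivative_vector_3:
  fixes f1 f2 f3 :: "'a::real_normed_vector \<Rightarrow> real"
  assumes "(f1 has_derivative f1') F" "(f2 has_derivative f2') F" "(f3 has_derivative f3') F"
  shows "((\<lambda>x. vector [f1 x, f2 x, f3 x] :: real ^ 3) has_derivative
    (\<lambda>h. vector [f1' h, f2' h, f3' h])) F"
  unfolding vector_3_eq_axis
  by (intro has_derivative_add has_derivative_scaleR_left assms)

lemma has_vector_derivative_vector_3:
  assumes "(f1 has_real_derivative d1) (at s)" "(f2 has_real_derivative d2) (at s)"
    "(f3 has_real_derivative d3) (at s)"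
  shows "((\<lambda>x. vector [f1 x, f2 x, f3 x] :: real ^ 3) has_vector_derivative vector [d1, d2, d3]) (at s)"
proof -
  have "(\<lambda>h. vector [d1 * h, d2 * h, d3 * h] :: real ^ 3) = (\<lambda>h. h *\<^sub>R vector [d1, d2, d3])"
    by (simp add: fun_eq_iff vec3_eq_iff)
  with has_derivative_vector_3[OF assms[unfolded has_field_derivative_def]] show ?thesis
    by (simp add: has_vector_derivative_def)
qed

lemma has_derivative_vec_nth: "((\<lambda>p. p $ i) has_derivative (\<lambda>h. h $ i)) (at (p :: real ^ 'n))"
  by (rule bounded_linear_imp_has_derivative[OF bounded_linear_vec_nth])

text \<open>As the metric is diagonal with coefficients in \<open>t\<close> alone, the Koszul
  formula leaves only these symbols: half the logarithmic derivatives \<open>- m\<close> and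
  \<open>n\<close> of the first two coefficients, and minus half their
  \<open>t\<close>-derivatives.\<close>

definition sol_gamma :: "real \<Rightarrow> real \<Rightarrow> 3 connection_form" where
  "sol_gamma m n p u v = vector
     [- m * (u $ 1 * v $ 3 + u $ 3 * v $ 1),
      n * (u $ 2 * v $ 3 + u $ 3 * v $ 2),
      m * exp (- 2 * m * p $ 3) * u $ 1 * v $ 1 - n * exp (2 * n * p $ 3) * u $ 2 * v $ 2]"

lemma frechet_derivative_sol_metric:
  "frechet_derivative (\<lambda>q. sol_metric m n q v w) (at p) =
    (\<lambda>h. - 2 * m * h $ 3 * exp (- 2 * m * p $ 3) * v $ 1 * w $ 1
       + 2 * n * h $ 3 * exp (2 * n * p $ 3) * v $ 2 * w $ 2)"
  unfolding sol_metric_def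
  by (rule frechet_derivative_at[symmetric])
    (auto intro!: derivative_eq_intros has_derivative_vec_nth simp: fun_eq_iff)

text \<open>The closed form is checked against the axioms directly; uniqueness then identifies it
  with \<open>levi_civita\<close>.\<close>

lemma is_levi_civita_sol_gamma: "is_levi_civita (sol_metric m n) (sol_gamma m n)"
  unfolding is_levi_civita_def frechet_derivative_sol_metric
  by (auto simp: bilinear_def sol_gamma_def sol_metric_def vec3_eq_iff algebra_simps intro!: linearI)

lemma levi_civita_sol_metric: "levi_civita (sol_metric m n) = sol_gamma m n"
  by (rule levi_civita_eqI[OF riemannian_metric_sol_metric is_levi_civita_sol_gamma])

lemma frechet_derivative_sol_gamma:
  "frechet_derivative (\<lambda>q. sol_gamma m n q u v) (at p) =
    (\<lambda>h. vector [0, 0,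
      - 2 * m\<^sup>2 * h $ 3 * exp (- 2 * m * p $ 3) * u $ 1 * v $ 1
      - 2 * n\<^sup>2 * h $ 3 * exp (2 * n * p $ 3) * u $ 2 * v $ 2])"
  unfolding sol_gamma_def
  by (rule frechet_derivative_at[symmetric], rule has_derivative_vector_3)
    (auto intro!: derivative_eq_intros has_derivative_vec_nth simp: fun_eq_iff power2_eq_square)

text \<open>Constant fields have zero flat derivative and commute, so the bracket term drops out and
  the inner \<open>nabla\<close> is \<Gamma> itself.\<close>

lemma curvature_sol_metric_const:
  "curvature (sol_metric m n) (\<lambda>_. w) (\<lambda>_. u) (\<lambda>_. v) p =
     frechet_derivative (\<lambda>q. sol_gamma m n q u v) (at p) w
     - frechet_derivative (\<lambda>q. sol_gamma m n q w v) (at p) u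
     + sol_gamma m n p w (sol_gamma m n p u v) - sol_gamma m n p u (sol_gamma m n p w v)"
proof -
  have "sol_gamma m n p 0 v = 0"
    by (simp add: sol_gamma_def vec3_eq_iff)
  moreover have "nabla (sol_gamma m n) (\<lambda>_. a) (\<lambda>_. v) = (\<lambda>q. sol_gamma m n q a v)" for a
    by (simp add: nabla_def fun_eq_iff)
  ultimately show ?thesis
    unfolding curvature_def levi_civita_sol_metric by (simp add: nabla_def lie_bracket_def)
qed

lemma ricci_sol_metric:
  "ricci (sol_metric m n) p u v =
     (m * n - m\<^sup>2) * exp (- 2 * m * p $ 3) * u $ 1 * v $ 1
     + (m * n - n\<^sup>2) * exp (2 * n * p $ 3) * u $ 2 * v $ 2 - (m\<^sup>2 + n\<^sup>2) * u $ 3 * v $ 3"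
  unfolding ricci_def curvature_sol_metric_const frechet_derivative_sol_gamma
  by (simp add: sum_3 sol_gamma_def axis_def algebra_simps power2_eq_square)

text \<open>Half the Lie derivative has coefficients \<open>- m * n - n\<^sup>2\<close> and
  \<open>- m * n - m\<^sup>2\<close> relative to the first two terms of the metric and 0 on the
  third, since \<open>c1\<close> cancels. Adding the Ricci coefficients gives
  \<open>- (m\<^sup>2 + n\<^sup>2)\<close> in all three directions.\<close>

lemma ricci_soliton_sol_metric:
  "ricci_soliton (sol_metric m n) (\<lambda>p. vector
     [(m * c1 - m * n - n\<^sup>2) * p $ 1 + c2, - ((n * c1 + m * n + m\<^sup>2) * p $ 2 + c3), c1])"
    (is "ricci_soliton _ ?\<xi>")
proof -
  have D: "(?\<xi> has_derivative
      (\<lambda>h. vector [(m * c1 - m * n - n\<^sup>2) * h $ 1, - ((n * c1 + m * n + m\<^sup>2) * h $ 2), 0])) (at p)" for p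
    by (rule has_derivative_vector_3) (auto intro!: derivative_eq_intros has_derivative_vec_nth)
  have "ricci (sol_metric m n) p u v + 1/2 * lie_derivative ?\<xi> (sol_metric m n) p u v =
      - (m\<^sup>2 + n\<^sup>2) * sol_metric m n p u v" for p u v
    unfolding ricci_sol_metric lie_derivative_def lie_bracket_def frechet_derivative_sol_metric
      frechet_derivative_at[OF D, symmetric]
    by (simp add: sol_metric_def algebra_simps power2_eq_square)
  with D show ?thesis
    unfolding ricci_soliton_def differentiable_def by blast
qed

text \<open>The explicit derivatives settle both differentiability clauses of
  \<open>geodesic\<close>; what remains is the vanishing of the three components of \<gamma>'' +
  \<Gamma>(\<gamma>', \<gamma>').\<close>

lemma geodesic_sol_metric_iff:
  assumes d: "\<And>s. (x has_real_derivative x' s) (at s)" "\<And>s. (y has_real_derivative y' s) (at s)"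
      "\<And>s. (t has_real_derivative t' s) (at s)"
    and dd: "\<And>s. (x' has_real_derivative x'' s) (at s)" "\<And>s. (y' has_real_derivative y'' s) (at s)"
      "\<And>s. (t' has_real_derivative t'' s) (at s)"
  shows "geodesic (sol_metric m n) (\<lambda>s. vector [x s, y s, t s]) \<longleftrightarrow>
    (\<forall>s. x'' s = 2 * m * x' s * t' s \<and> y'' s = - 2 * n * y' s * t' s \<and>
      t'' s + m * exp (- 2 * m * t s) * (x' s)\<^sup>2 = n * exp (2 * n * t s) * (y' s)\<^sup>2)"
proof -
  have D: "((\<lambda>s. vector [x s, y s, t s] :: real ^ 3) has_vector_derivative vector [x' s, y' s, t' s]) (at s)"
    for s by (intro has_vector_derivative_vector_3 d)
  have DD: "((\<lambda>s. vector [x' s, y' s, t' s] :: real ^ 3) has_vector_derivative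
      vector [x'' s, y'' s, t'' s]) (at s)" for s
    by (intro has_vector_derivative_vector_3 dd)
  show ?thesis
    unfolding geodesic_def covariant_derivative_along_def levi_civita_sol_metric
      vector_derivative_at[OF D] vector_derivative_at[OF DD]
    using differentiableI_vector[OF D] differentiableI_vector[OF DD]
    by (auto simp: sol_gamma_def vec3_eq_iff eq_neg_iff_add_eq_0 algebra_simps power2_eq_square)
qed

theorem corollary8:
  fixes m n c1 c2 c3 a1 a2 t0 :: real
    and \<xi> :: "real ^ 3 \<Rightarrow> real ^ 3"
    and \<gamma> :: "real \<Rightarrow> real ^ 3"
  assumes "m > 0" and "n > 0"
    and "m * c1 - m * n - n^2 \<noteq> 0"
    and "n * c1 + m * n + m^2 \<noteq> 0"
    and "\<xi> = (\<lambda>p. vector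
           [(m * c1 - m * n - n^2) * p $ 1 + c2,
            - ((n * c1 + m * n + m^2) * p $ 2 + c3),
            c1])"
    and "\<gamma> = (\<lambda>s. vector
           [a1 * exp ((m * c1 - m * n - n^2) * s) - c2 / (m * c1 - m * n - n^2),
            a2 * exp (- (n * c1 + m * n + m^2) * s) - c3 / (n * c1 + m * n + m^2),
            c1 * s + t0])"
  shows "ricci_soliton (sol_metric m n) \<xi> \<and>
    integral_curve \<xi> \<gamma> \<and>
    (geodesic (sol_metric m n) \<gamma> \<longleftrightarrow>
       a1 * (m^2 * c1^2 - m^2 * n^2 - 2 * m * n^3 - n^4) = 0 \<and>
       a2 * (n^2 * c1^2 - m^2 * n^2 - 2 * m^3 * n - m^4) = 0 \<and>
       (\<forall>s. m * a1^2 * (m * c1 - m * n - n^2)^2 * exp (- 2 * n^2 * s - 2 * m * t0)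
            = n * a2^2 * (n * c1 + m * n + m^2)^2 * exp (- 2 * m^2 * s + 2 * n * t0)))"
proof -
  define A where "A = m * c1 - m * n - n\<^sup>2"
  define B where "B = n * c1 + m * n + m\<^sup>2"
  note AB = A_def[symmetric] B_def[symmetric]
  have A0: "A \<noteq> 0" and B0: "B \<noteq> 0"
    using assms(3,4) by (simp_all add: A_def B_def)
  have g: "\<gamma> = (\<lambda>s. vector [a1 * exp (A * s) - c2 / A, a2 * exp (- B * s) - c3 / B, c1 * s + t0])"
    using assms(6) by (simp only: AB)
  have "integral_curve \<xi> \<gamma>"
    unfolding integral_curve_def
  proof
    fix s
    have "(\<gamma> has_vector_derivative vector [a1 * A * exp (A * s), - a2 * B * exp (- B * s), c1]) (at s)"
      unfolding g by (rule has_vector_derivative_vector_3) (auto intro!: derivative_eq_intros)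
    \<comment> \<open>The shifts \<open>- c2 / A\<close> and \<open>- c3 / B\<close> cancel the
      constants \<open>c2\<close> and \<open>c3\<close> of the field, which uses that
      \<open>A\<close> and \<open>B\<close> are nonzero.\<close>
    moreover have "\<xi> (\<gamma> s) = vector [a1 * A * exp (A * s), - a2 * B * exp (- B * s), c1]"
      unfolding assms(5) AB g using A0 B0 by (simp add: vec3_eq_iff field_simps)
    ultimately show "(\<gamma> has_vector_derivative \<xi> (\<gamma> s)) (at s)"
      by simp
  qed
  moreover have "geodesic (sol_metric m n) \<gamma> \<longleftrightarrow>
      a1 * (m^2 * c1^2 - m^2 * n^2 - 2 * m * n^3 - n^4) = 0 \<and>
      a2 * (n^2 * c1^2 - m^2 * n^2 - 2 * m^3 * n - m^4) = 0 \<and>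
      (\<forall>s. m * a1^2 * A^2 * exp (- 2 * n^2 * s - 2 * m * t0)
           = n * a2^2 * B^2 * exp (- 2 * m^2 * s + 2 * n * t0))"
  proof -
    have "geodesic (sol_metric m n) \<gamma> \<longleftrightarrow>
      (\<forall>s. a1 * A\<^sup>2 * exp (A * s) = 2 * m * (a1 * A * exp (A * s)) * c1 \<and>
        a2 * B\<^sup>2 * exp (- B * s) = - 2 * n * (- a2 * B * exp (- B * s)) * c1 \<and>
        0 + m * exp (- 2 * m * (c1 * s + t0)) * (a1 * A * exp (A * s))\<^sup>2
          = n * exp (2 * n * (c1 * s + t0)) * (- a2 * B * exp (- B * s))\<^sup>2)"
      unfolding g
      by (rule geodesic_sol_metric_iff) (auto intro!: derivative_eq_intros simp: power2_eq_square)
    moreover have "a1 * A\<^sup>2 * exp (A * s) = 2 * m * (a1 * A * exp (A * s)) * c1 \<longleftrightarrow>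
        a1 * (m^2 * c1^2 - m^2 * n^2 - 2 * m * n^3 - n^4) = 0" (is "?l s = ?r s \<longleftrightarrow> _") for s
    proof -
      \<comment> \<open>A difference of squares: with \<open>k = m * n + n\<^sup>2\<close> the
        factors are \<open>A = m * c1 - k\<close> and
        \<open>A - 2 * m * c1 = - (m * c1 + k)\<close>.\<close>
      have "m^2 * c1^2 - m^2 * n^2 - 2 * m * n^3 - n^4 = - (A * (A - 2 * m * c1))"
        by (simp add: A_def algebra_simps power2_eq_square power3_eq_cube power4_eq_xxxx)
      moreover have "a1 * A\<^sup>2 * exp (A * s) - 2 * m * (a1 * A * exp (A * s)) * c1
          = exp (A * s) * (a1 * (A * (A - 2 * m * c1)))"
        by (simp add: algebra_simps power2_eq_square)
      ultimately show ?thesis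
        by (simp only: eq_iff_diff_eq_0[of "?l s" "?r s"]) simp
    qed
    moreover have "a2 * B\<^sup>2 * exp (- B * s) = - 2 * n * (- a2 * B * exp (- B * s)) * c1 \<longleftrightarrow>
        a2 * (n^2 * c1^2 - m^2 * n^2 - 2 * m^3 * n - m^4) = 0" (is "?l s = ?r s \<longleftrightarrow> _") for s
    proof -
      \<comment> \<open>Likewise with \<open>k = m * n + m\<^sup>2\<close>, where
        \<open>B = k + n * c1\<close> and \<open>B - 2 * n * c1 = k - n * c1\<close>.\<close>
      have "n^2 * c1^2 - m^2 * n^2 - 2 * m^3 * n - m^4 = - (B * (B - 2 * n * c1))"
        by (simp add: B_def algebra_simps power2_eq_square power3_eq_cube power4_eq_xxxx)
      moreover have "a2 * B\<^sup>2 * exp (- B * s) - - 2 * n * (- a2 * B * exp (- B * s)) * c1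
          = exp (- B * s) * (a2 * (B * (B - 2 * n * c1)))"
        by (simp add: algebra_simps power2_eq_square)
      ultimately show ?thesis
        by (simp only: eq_iff_diff_eq_0[of "?l s" "?r s"]) simp
    qed
    moreover have "0 + m * exp (- 2 * m * (c1 * s + t0)) * (a1 * A * exp (A * s))\<^sup>2
          = n * exp (2 * n * (c1 * s + t0)) * (- a2 * B * exp (- B * s))\<^sup>2 \<longleftrightarrow>
        m * a1^2 * A^2 * exp (- 2 * n^2 * s - 2 * m * t0)
          = n * a2^2 * B^2 * exp (- 2 * m^2 * s + 2 * n * t0)" for s
    proof -
      \<comment> \<open>The two sides of the \<open>t\<close>-equation share the factor \<open>exp (- 2 * m * n * s)\<close>.\<close>
      have "exp (- 2 * m * (c1 * s + t0)) * (exp (A * s))\<^sup>2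
          = exp (- 2 * m * n * s) * exp (- 2 * n^2 * s - 2 * m * t0)"
        "exp (2 * n * (c1 * s + t0)) * (exp (- B * s))\<^sup>2
          = exp (- 2 * m * n * s) * exp (- 2 * m^2 * s + 2 * n * t0)"
        unfolding exp_double[symmetric] exp_add[symmetric] by (simp_all add: A_def B_def algebra_simps)
      then have shared:
        "0 + m * exp (- 2 * m * (c1 * s + t0)) * (a1 * A * exp (A * s))\<^sup>2
          = exp (- 2 * m * n * s) * (m * a1^2 * A^2 * exp (- 2 * n^2 * s - 2 * m * t0))"
        "n * exp (2 * n * (c1 * s + t0)) * (- a2 * B * exp (- B * s))\<^sup>2
          = exp (- 2 * m * n * s) * (n * a2^2 * B^2 * exp (- 2 * m^2 * s + 2 * n * t0))"
        by (simp_all add: power_mult_distrib mult_ac)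
      show ?thesis
        unfolding shared by simp
    qed
    \<comment> \<open>The first two conditions no longer mention \<open>s\<close>, so the quantifier
      survives only on the third.\<close>
    ultimately show ?thesis
      by blast
  qed
  ultimately show ?thesis
    unfolding assms(5) A_def B_def using ricci_soliton_sol_metric by blast
qed

end
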